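(* In the setting described in the context, assume (A5) and (A6), and suppose that for some $i'\in\{1,\dots,t\}$ the scalarized problem $(\mathrm{P}_{i'})$ is in Case 3 (this is Case III) or in Case 4 (this is Case IV). Then $(\mathrm{P}_{i'})$ has a unique minimizer $u^{(i')}$, and $u^{(i')}$ is an efficient solution to the multi-objective problem (MFSIPP).
   Context: Let $x=(x_1,\dots,x_m)$, $y=(y_1,\dots,y_n)$, $f_i,g_i\in\mathbb{R}[x]$ ($i=1,\dots,t$), $p\in\mathbb{R}[x,y]$, $\mathbf{Y}\subset\mathbb{R}^n$, and $\mathbf{F}:=\{x\in\mathbb{R}^m:p(x,y)\le 0\ \forall y\in\mathbf{Y}\}$. The multi-objective fractional semi-infinite polynomial problem (MFSIPP) is to minimize $\left(\frac{f_1(x)}{g_1(x)},\dots,\frac{f_t(x)}{g_t(x)}\right)$ over $x\in\mathbf{F}$ with respect to the partial order induced by $\mathbb{R}_+^t$. A point $u^{\star}\in\mathbf{F}$ is an efficient solution if $$\left(\tfrac{f_1(x)}{g_1(x)},\dots,\tfrac{f_t(x)}{g_t(x)}\right)-\left(\tfrac{f_1(u^{\star})}{g_1(u^{\star})},\dots,\tfrac{f_t(u^{\star})}{g_t(u^{\star})}\right)\notin-\mathbb{R}_+^t\setminus\{0\}\quad\text{for all }x\in\mathbf{F}.$$ (A5): $\mathbf{Y}$ is compact; $f_i$, $-g_i$ ($i=1,\dots,t$) and $p(\cdot,y)$ for every $y\in\mathbf{Y}$ are all convex in $x$. (A6): For each $i=1,\dots,t$, either $f_i(x)\ge 0$ and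 $g_i(x)>0$ for all $x\in\mathbf{F}$; or $g_i$ is affine and $g_i(x)>0$ for all $x\in\mathbf{F}$. Scalarized problems ($\epsilon$-constraint method): choose an initial point $u^{(0)}\in\mathbf{F}$; successively for $i=1,2,\dots$, given $u^{(i-1)}\in\mathbf{F}$, $(\mathrm{P}_i)$ is the problem $$r_i:=\min_{x\in\mathbf{F}}\ \frac{f_i(x)}{g_i(x)}\quad\text{s.t.}\quad g_j(u^{(i-1)})f_j(x)-f_j(u^{(i-1)})g_j(x)\le 0,\ \ j\neq i,$$ and $u^{(i)}$ denotes a minimizer of $(\mathrm{P}_i)$. $(\mathrm{P}_{i'})$ is in Case 3 if $n=1$, $\mathbf{Y}=[-1,1]$, and the Hessian $\nabla^2f_{i'}(u^{\star})\succ 0$ at some optimal solution $u^{\star}$ of $(\mathrm{P}_{i'})$. $(\mathrm{P}_{i'})$ is in Case 4 if $n>1$, $\mathbf{Y}=\{y\in\mathbb{R}^n:\phi(y)\ge 0\}$ with $\deg\phi=2$ and $\phi(\bar y)>0$ for some $\bar y\in\mathbb{R}^n$, $\deg_y p(x,y)=2$, and the Hessian $\nabla^2f_{i'}(u^{\star})\succ 0$ at some optimal solution $u^{\star}$ of $(\mathrm{P}_{i'})$. *)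

theory Defs
  imports
    "HOL-Analysis.Analysis"
    "HOL-Library.Poly_Mapping"
    "HOL-Library.Function_Algebras"
begin

text \<open>
  Real polynomials in the variables \<open>'v\<close>: finitely supported maps from exponent vectors to
  coefficients. \<open>\<real>[x]\<close> is \<open>'m rpoly\<close>, and \<open>\<real>[x, y]\<close> is \<open>('m + 'n) rpoly\<close>, where \<open>Inl j\<close>
  stands for \<open>x\<^sub>j\<close> and \<open>Inr k\<close> for \<open>y\<^sub>k\<close>.
\<close>

type_synonym 'v rpoly = "('v \<Rightarrow>\<^sub>0 nat) \<Rightarrow>\<^sub>0 real"

definition eval :: "'v rpoly \<Rightarrow> ('v \<Rightarrow> real) \<Rightarrow> real" where
  "eval P a = (\<Sum>\<alpha>\<in>Poly_Mapping.keys P. Poly_Mapping.lookup P \<alpha> *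
      (\<Prod>v\<in>Poly_Mapping.keys \<alpha>. a v ^ Poly_Mapping.lookup \<alpha> v))"

definition eval_vec :: "'m::finite rpoly \<Rightarrow> real^'m \<Rightarrow> real" where
  "eval_vec P x = eval P (($) x)"

definition eval_vec2 :: "('m::finite + 'n::finite) rpoly \<Rightarrow> real^'m \<Rightarrow> real^'n \<Rightarrow> real" where
  "eval_vec2 P x y = eval P (case_sum (($) x) (($) y))"

text \<open>
  Degree with respect to the variables in \<open>V\<close>, the other variables counting as coefficients.
  The zero polynomial gets degree 0.
\<close>

definition degree_in :: "'v set \<Rightarrow> 'v rpoly \<Rightarrow> nat" where
  "degree_in V P = Max (insert 0
      ((\<lambda>\<alpha>. \<Sum>v\<in>Poly_Mapping.keys \<alpha> \<inter> V. Poly_Mapping.lookup \<alpha> v) ` Poly_Mapping.keys P))"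

abbreviation total_degree :: "'v rpoly \<Rightarrow> nat" where
  "total_degree \<equiv> degree_in UNIV"

abbreviation degree_y :: "('m + 'n) rpoly \<Rightarrow> nat" where
  "degree_y \<equiv> degree_in (range Inr)"

definition partial_deriv :: "'m::finite \<Rightarrow> (real^'m \<Rightarrow> real) \<Rightarrow> real^'m \<Rightarrow> real" where
  "partial_deriv j h x = deriv (\<lambda>s. h (x + s *\<^sub>R axis j 1)) 0"

definition hessian :: "(real^'m::finite \<Rightarrow> real) \<Rightarrow> real^'m \<Rightarrow> real^'m^'m" where
  "hessian h x = (\<chi> j k. partial_deriv j (partial_deriv k h) x)"

definition positive_definite :: "real^'m::finite^'m \<Rightarrow> bool" where
  "positive_definite A \<longleftrightarrow> transpose A = A \<and> (\<forall>v. v \<noteq> 0 \<longrightarrow> v \<bullet> (A *v v) > 0)"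

definition affine_fun :: "('a::real_inner \<Rightarrow> real) \<Rightarrow> bool" where
  "affine_fun h \<longleftrightarrow> (\<exists>a b. \<forall>x. h x = a \<bullet> x + b)"

definition feasible :: "('m::finite + 'n::finite) rpoly \<Rightarrow> (real^'n) set \<Rightarrow> (real^'m) set" where
  "feasible p Y = {x. \<forall>y\<in>Y. eval_vec2 p x y \<le> 0}"

text \<open>
  The families \<open>f\<close>, \<open>g\<close> matter only at the indices \<open>1, \<dots>, t\<close>. Vectors in \<open>\<real>\<^sup>t\<close> are functions
  on \<open>nat\<close> that vanish outside these indices.
\<close>

definition ratio :: "(nat \<Rightarrow> 'm::finite rpoly) \<Rightarrow> (nat \<Rightarrow> 'm rpoly) \<Rightarrow> nat \<Rightarrow> real^'m \<Rightarrow> real" where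
  "ratio f g i x = eval_vec (f i) x / eval_vec (g i) x"

definition objective ::
  "nat \<Rightarrow> (nat \<Rightarrow> 'm::finite rpoly) \<Rightarrow> (nat \<Rightarrow> 'm rpoly) \<Rightarrow> real^'m \<Rightarrow> nat \<Rightarrow> real" where
  "objective t f g x = (\<lambda>i. if i \<in> {1..t} then ratio f g i x else 0)"

definition nonneg_orthant :: "nat \<Rightarrow> (nat \<Rightarrow> real) set" where
  "nonneg_orthant t = {v. (\<forall>i\<in>{1..t}. 0 \<le> v i) \<and> (\<forall>i. i \<notin> {1..t} \<longrightarrow> v i = 0)}"

definition efficient_solution ::
  "nat \<Rightarrow> (nat \<Rightarrow> 'm::finite rpoly) \<Rightarrow> (nat \<Rightarrow> 'm rpoly) \<Rightarrow> ('m + 'n::finite) rpoly \<Rightarrow>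
    (real^'n) set \<Rightarrow> real^'m \<Rightarrow> bool" where
  "efficient_solution t f g p Y u \<longleftrightarrow> u \<in> feasible p Y \<and>
    (\<forall>x\<in>feasible p Y. objective t f g x - objective t f g u \<notin> uminus ` nonneg_orthant t - {0})"

definition A5 ::
  "nat \<Rightarrow> (nat \<Rightarrow> 'm::finite rpoly) \<Rightarrow> (nat \<Rightarrow> 'm rpoly) \<Rightarrow> ('m + 'n::finite) rpoly \<Rightarrow>
    (real^'n) set \<Rightarrow> bool" where
  "A5 t f g p Y \<longleftrightarrow> compact Y \<and>
    (\<forall>i\<in>{1..t}. convex_on UNIV (eval_vec (f i)) \<and> convex_on UNIV (\<lambda>x. - eval_vec (g i) x)) \<and>
    (\<forall>y\<in>Y. convex_on UNIV (\<lambda>x. eval_vec2 p x y))"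

definition A6 ::
  "nat \<Rightarrow> (nat \<Rightarrow> 'm::finite rpoly) \<Rightarrow> (nat \<Rightarrow> 'm rpoly) \<Rightarrow> ('m + 'n::finite) rpoly \<Rightarrow>
    (real^'n) set \<Rightarrow> bool" where
  "A6 t f g p Y \<longleftrightarrow> (\<forall>i\<in>{1..t}.
      (\<forall>x\<in>feasible p Y. eval_vec (f i) x \<ge> 0 \<and> eval_vec (g i) x > 0) \<or>
      (affine_fun (eval_vec (g i)) \<and> (\<forall>x\<in>feasible p Y. eval_vec (g i) x > 0)))"

text \<open>The scalarized problem \<open>(P\<^sub>i)\<close>; the argument \<open>w\<close> is the previous iterate \<open>u (i - 1)\<close>.\<close>

definition scalarized_feasible ::
  "nat \<Rightarrow> (nat \<Rightarrow> 'm::finite rpoly) \<Rightarrow> (nat \<Rightarrow> 'm rpoly) \<Rightarrow> ('m + 'n::finite) rpoly \<Rightarrow>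
    (real^'n) set \<Rightarrow> nat \<Rightarrow> real^'m \<Rightarrow> (real^'m) set" where
  "scalarized_feasible t f g p Y i w = {x \<in> feasible p Y. \<forall>j\<in>{1..t} - {i}.
      eval_vec (g j) w * eval_vec (f j) x - eval_vec (f j) w * eval_vec (g j) x \<le> 0}"

definition scalarized_minimizer ::
  "nat \<Rightarrow> (nat \<Rightarrow> 'm::finite rpoly) \<Rightarrow> (nat \<Rightarrow> 'm rpoly) \<Rightarrow> ('m + 'n::finite) rpoly \<Rightarrow>
    (real^'n) set \<Rightarrow> nat \<Rightarrow> real^'m \<Rightarrow> real^'m \<Rightarrow> bool" where
  "scalarized_minimizer t f g p Y i w v \<longleftrightarrow>
    is_arg_min (ratio f g i) (\<lambda>x. x \<in> scalarized_feasible t f g p Y i w) v"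

text \<open>As \<open>CARD('n) = 1\<close>, the condition on \<open>Y\<close> is \<open>Y = [-1, 1]\<close> under \<open>real^'n = \<real>\<close>.\<close>

definition case3 ::
  "nat \<Rightarrow> (nat \<Rightarrow> 'm::finite rpoly) \<Rightarrow> (nat \<Rightarrow> 'm rpoly) \<Rightarrow> ('m + 'n::finite) rpoly \<Rightarrow>
    (real^'n) set \<Rightarrow> nat \<Rightarrow> real^'m \<Rightarrow> bool" where
  "case3 t f g p Y i w \<longleftrightarrow>
    CARD('n) = 1 \<and> Y = {y. \<forall>k. y $ k \<in> {-1..1}} \<and>
    (\<exists>v. scalarized_minimizer t f g p Y i w v \<and> positive_definite (hessian (eval_vec (f i)) v))"

definition case4 ::
  "nat \<Rightarrow> (nat \<Rightarrow> 'm::finite rpoly) \<Rightarrow> (nat \<Rightarrow> 'm rpoly) \<Rightarrow> ('m + 'n::finite) rpoly \<Rightarrow>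
    (real^'n) set \<Rightarrow> nat \<Rightarrow> real^'m \<Rightarrow> bool" where
  "case4 t f g p Y i w \<longleftrightarrow>
    CARD('n) > 1 \<and>
    (\<exists>\<phi> :: 'n rpoly. Y = {y. eval_vec \<phi> y \<ge> 0} \<and> total_degree \<phi> = 2 \<and> (\<exists>y. eval_vec \<phi> y > 0)) \<and>
    degree_y p = 2 \<and>
    (\<exists>v. scalarized_minimizer t f g p Y i w v \<and> positive_definite (hessian (eval_vec (f i)) v))"

end

theory Submission
  imports Defs
begin

text \<open>
  Let \<open>v\<close> be the minimizer with positive definite Hessian, \<open>r\<close> the optimal value and \<open>v'\<close> another
  minimizer. On the segment from \<open>v\<close> to \<open>v'\<close>, which is feasible, \<open>f \<ge> r g\<close>, with equality at both
  ends; since \<open>f\<close> is convex and \<open>r g\<close> is concave, both are affine there. So the second derivative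
  of \<open>f\<close> at \<open>v\<close> in the direction \<open>v' - v\<close> vanishes, which contradicts positive definiteness.
  A feasible point that dominates the unique minimizer is feasible for the scalarized problem and
  minimizes it too, so it is that minimizer.
\<close>

section \<open>First and second derivatives of real polynomial functions\<close>

lemma real_polynomial_function_eval_vec: "real_polynomial_function (eval_vec P)"
proof -
  have "real_polynomial_function (\<lambda>x::real^'m. x $ v)" for v
    by (intro real_polynomial_function.intros(1) bounded_linear_vec_nth)
  then show ?thesis
    unfolding eval_vec_def[abs_def] eval_def
    by (intro real_polynomial_function_sum finite_keys
        real_polynomial_function.intros(4)[OF real_polynomial_function.intros(2)]
        real_polynomial_function_prod real_polynomial_function_power)
qed

text \<open>Induction on the generation of polynomial functions by the sum and product rules. That
  the partial derivatives are again polynomial is part of the claim, so that the lemma can be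
  applied a second time, to each \<open>G k\<close>, to reach the Hessian.\<close>

lemma real_polynomial_function_gradient:
  fixes h :: "real^'m::finite \<Rightarrow> real"
  assumes "real_polynomial_function h"
  obtains G where "\<And>k. real_polynomial_function (G k)"
    and "\<And>x. (h has_derivative (\<lambda>d. \<Sum>k\<in>UNIV. d $ k * G k x)) (at x)"
proof -
  have "\<exists>G. (\<forall>k. real_polynomial_function (G k)) \<and>
      (\<forall>x. (h has_derivative (\<lambda>d. \<Sum>k\<in>UNIV. d $ k * G k x)) (at x))"
    using assms
  proof induction
    case (linear h)
    interpret bounded_linear h by (rule linear)
    have "h = (\<lambda>d. \<Sum>k\<in>UNIV. d $ k * h (axis k 1))"
    proof
      fix d
      have "h d = h (\<Sum>k\<in>UNIV. d $ k *\<^sub>R axis k 1)"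
        using basis_expansion[of d] by (simp add: scalar_mult_eq_scaleR)
      also have "\<dots> = (\<Sum>k\<in>UNIV. d $ k * h (axis k 1))"
        by (simp add: sum scaleR)
      finally show "h d = (\<Sum>k\<in>UNIV. d $ k * h (axis k 1))" .
    qed
    moreover have "(h has_derivative h) (at x)" for x
      by (rule has_derivative) (rule has_derivative_ident)
    ultimately have "(h has_derivative (\<lambda>d. \<Sum>k\<in>UNIV. d $ k * h (axis k 1))) (at x)" for x
      by metis
    then show ?case
      by (intro exI[of _ "\<lambda>k x. h (axis k 1)"]) auto
  next
    case (const c)
    show ?case
      by (intro exI[of _ "\<lambda>k x. 0"]) auto
  next
    case (add h1 h2)
    then obtain G1 G2 where "\<forall>k. real_polynomial_function (G1 k)"
      "\<forall>x. (h1 has_derivative (\<lambda>d. \<Sum>k\<in>UNIV. d $ k * G1 k x)) (at x)"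
      "\<forall>k. real_polynomial_function (G2 k)"
      "\<forall>x. (h2 has_derivative (\<lambda>d. \<Sum>k\<in>UNIV. d $ k * G2 k x)) (at x)"
      by blast
    note G = this
    have "((\<lambda>x. h1 x + h2 x) has_derivative (\<lambda>d. \<Sum>k\<in>UNIV. d $ k * (G1 k x + G2 k x))) (at x)" for x
      using has_derivative_add[OF G(2)[rule_format] G(4)[rule_format], of x]
      by (simp add: distrib_left sum.distrib)
    with G(1,3) show ?case
      by (intro exI[of _ "\<lambda>k x. G1 k x + G2 k x"]) blast
  next
    case (mult h1 h2)
    then obtain G1 G2 where "\<forall>k. real_polynomial_function (G1 k)"
      "\<forall>x. (h1 has_derivative (\<lambda>d. \<Sum>k\<in>UNIV. d $ k * G1 k x)) (at x)"
      "\<forall>k. real_polynomial_function (G2 k)"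
      "\<forall>x. (h2 has_derivative (\<lambda>d. \<Sum>k\<in>UNIV. d $ k * G2 k x)) (at x)"
      by blast
    note G = this
    have "((\<lambda>x. h1 x * h2 x) has_derivative
        (\<lambda>d. \<Sum>k\<in>UNIV. d $ k * (h1 x * G2 k x + G1 k x * h2 x))) (at x)" for x
      using has_derivative_mult[OF G(2)[rule_format] G(4)[rule_format], of x]
      by (simp add: distrib_left sum.distrib sum_distrib_left sum_distrib_right mult_ac)
    with G(1,3) mult.hyps show ?case
      by (intro exI[of _ "\<lambda>k x. h1 x * G2 k x + G1 k x * h2 x"]
          conjI allI real_polynomial_function.intros(3,4)) simp_all
  qed
  with that show thesis by blast
qed

lemma DERIV_along_line:
  fixes h :: "real^'m::finite \<Rightarrow> real"
  assumes "\<And>x. (h has_derivative (\<lambda>d. \<Sum>k\<in>UNIV. d $ k * G k x)) (at x)"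
  shows "((\<lambda>s. h (x + s *\<^sub>R d)) has_real_derivative (\<Sum>k\<in>UNIV. d $ k * G k (x + s *\<^sub>R d))) (at s)"
proof -
  have "((\<lambda>s. x + s *\<^sub>R d) has_derivative (\<lambda>s. s *\<^sub>R d)) (at s)"
    by (auto intro!: derivative_eq_intros)
  from diff_chain_at[OF this assms] show ?thesis
    unfolding has_field_derivative_def o_def
    by (rule has_derivative_eq_rhs) (simp add: fun_eq_iff sum_distrib_left mult_ac)
qed

text \<open>An equality of functions rather than of values at one point: this lets it rewrite the
  inner \<open>partial_deriv k h\<close> in \<open>hessian\<close>, which the outer partial
  derivative differentiates.\<close>

lemma partial_deriv_eq:
  fixes h :: "real^'m::finite \<Rightarrow> real"
  assumes "\<And>x. (h has_derivative (\<lambda>d. \<Sum>k\<in>UNIV. d $ k * G k x)) (at x)"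
  shows "partial_deriv j h = G j"
proof
  fix x
  have "(\<Sum>k\<in>UNIV. axis j 1 $ k * G k x) = G j x"
    by (simp add: axis_def if_distrib[of "\<lambda>c. c * _"] cong: if_cong)
  with DERIV_along_line[OF assms, of x "axis j 1" 0] show "partial_deriv j h x = G j x"
    by (auto simp: partial_deriv_def intro: DERIV_imp_deriv)
qed

text \<open>The chain rule along the line, applied to \<open>h\<close> and then to each component of
  its gradient, shows that the quadratic form of the Hessian is a second directional
  derivative.\<close>

lemma hessian_second_derivative:
  fixes h :: "real^'m::finite \<Rightarrow> real"
  assumes "real_polynomial_function h"
  obtains h' where "\<And>s. ((\<lambda>s. h (x + s *\<^sub>R d)) has_real_derivative h' s) (at s)"
    and "(h' has_real_derivative d \<bullet> (hessian h x *v d)) (at 0)"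
proof -
  obtain G where G: "\<And>k. real_polynomial_function (G k)"
    "\<And>x. (h has_derivative (\<lambda>d. \<Sum>k\<in>UNIV. d $ k * G k x)) (at x)"
    using real_polynomial_function_gradient[OF assms] by blast
  have "\<forall>k. \<exists>K. \<forall>x. (G k has_derivative (\<lambda>d. \<Sum>j\<in>UNIV. d $ j * K j x)) (at x)"
  proof
    fix k
    show "\<exists>K. \<forall>x. (G k has_derivative (\<lambda>d. \<Sum>j\<in>UNIV. d $ j * K j x)) (at x)"
      by (rule real_polynomial_function_gradient[OF G(1)[of k]]) auto
  qed
  from choice[OF this] obtain K
    where K: "\<And>k x. (G k has_derivative (\<lambda>d. \<Sum>j\<in>UNIV. d $ j * K k j x)) (at x)"
    by blast
  \<comment> \<open>\<open>K k j\<close> is the partial derivative of \<open>G k\<close> in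
    direction \<open>j\<close>, so the indices come out transposed; swapping the two sums below
    collects the terms belonging to each \<open>G k\<close>.\<close>
  have "hessian h x = (\<chi> j k. K k j x)"
    by (simp add: hessian_def partial_deriv_eq[OF G(2)] partial_deriv_eq[OF K])
  then have "d \<bullet> (hessian h x *v d) = (\<Sum>j\<in>UNIV. \<Sum>k\<in>UNIV. d $ j * (K k j x * d $ k))"
    by (simp add: inner_vec_def matrix_vector_mult_def sum_distrib_left)
  also have "\<dots> = (\<Sum>k\<in>UNIV. d $ k * (\<Sum>j\<in>UNIV. d $ j * K k j x))"
    by (subst sum.swap) (simp add: sum_distrib_left mult_ac)
  finally have eq: "d \<bullet> (hessian h x *v d) = (\<Sum>k\<in>UNIV. d $ k * (\<Sum>j\<in>UNIV. d $ j * K k j x))" .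
  show thesis
  proof
    show "((\<lambda>s. h (x + s *\<^sub>R d)) has_real_derivative (\<Sum>k\<in>UNIV. d $ k * G k (x + s *\<^sub>R d))) (at s)"
      for s by (rule DERIV_along_line[OF G(2)])
    have "((\<lambda>s. d $ k * G k (x + s *\<^sub>R d)) has_real_derivative
        d $ k * (\<Sum>j\<in>UNIV. d $ j * K k j x)) (at 0)" for k
      using DERIV_cmult[OF DERIV_along_line[OF K, of k x d 0]] by simp
    then show "((\<lambda>s. \<Sum>k\<in>UNIV. d $ k * G k (x + s *\<^sub>R d)) has_real_derivative
        d \<bullet> (hessian h x *v d)) (at 0)"
      unfolding eq by (intro DERIV_sum)
  qed
qed

section \<open>Second derivatives along affine segments\<close>

lemma DERIV_unique_on_interval:
  fixes a b s :: real
  assumes "(\<phi> has_real_derivative D) (at s)" "(\<psi> has_real_derivative E) (at s)"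
    and "a < b" "s \<in> {a..b}" "\<And>s. s \<in> {a..b} \<Longrightarrow> \<phi> s = \<psi> s"
  shows "D = E"
proof -
  \<comment> \<open>The functions agree on the closed interval only, so both derivatives are
    restricted to it. Uniqueness survives even at an endpoint, which matters because the minimizer
    sits at \<open>s = 0\<close>.\<close>
  have "(\<phi> has_real_derivative D) (at s within {a..b})"
    using assms(1) by (rule has_field_derivative_at_within)
  then have "(\<psi> has_real_derivative D) (at s within {a..b})"
    by (rule has_field_derivative_transform_within[where d = 1]) (use assms in auto)
  moreover have "(\<psi> has_real_derivative E) (at s within {a..b})"
    using assms(2) by (rule has_field_derivative_at_within)
  ultimately show ?thesis
    using vector_derivative_unique_within_closed_interval[of a b s \<psi> D E] assms
    by (simp add: has_real_derivative_iff_has_vector_derivative)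
qed

text \<open>Uniqueness of derivatives on \<open>{0..1}\<close> is used twice: first
  \<open>h'\<close> equals the constant slope \<open>c\<close> there, then the derivative of
  \<open>h'\<close> at the endpoint 0 is that of a constant.\<close>

lemma hessian_zero_along_affine_segment:
  fixes h :: "real^'m::finite \<Rightarrow> real"
  assumes "real_polynomial_function h"
    and affine: "\<And>s. s \<in> {0..1} \<Longrightarrow> h (x + s *\<^sub>R d) = (1 - s) * h x + s * h (x + d)"
  shows "d \<bullet> (hessian h x *v d) = 0"
proof -
  obtain h' where h': "\<And>s. ((\<lambda>s. h (x + s *\<^sub>R d)) has_real_derivative h' s) (at s)"
    "(h' has_real_derivative d \<bullet> (hessian h x *v d)) (at 0)"
    using hessian_second_derivative[OF assms(1)] by blast
  define c where "c = h (x + d) - h x"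
  have "((\<lambda>s. (1 - s) * h x + s * h (x + d)) has_real_derivative c) (at s)" for s
    by (auto intro!: derivative_eq_intros simp: c_def)
  then have "h' s = c" if "s \<in> {0..1}" for s
    using DERIV_unique_on_interval[OF h'(1) _ _ that affine] by auto
  then show ?thesis
    using DERIV_unique_on_interval[OF h'(2) DERIV_const[of c], of 0 1] by auto
qed

section \<open>Uniqueness of minimizers of convex fractional problems\<close>

text \<open>The two alternatives mirror those of \<open>A6\<close>: a nonnegative multiple of a
  convex function is convex, and for affine \<open>g\<close> the product is affine whatever the sign
  of \<open>b\<close>.\<close>

lemma convex_on_neg_mult:
  assumes "convex_on UNIV (\<lambda>x. - g x)" "b \<ge> 0 \<or> affine_fun g"
  shows "convex_on UNIV (\<lambda>x. - (b * g x :: real))"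
  using assms(2)
proof
  assume "b \<ge> 0"
  with convex_on_cmul[OF this assms(1)] show ?thesis by simp
next
  assume "affine_fun g"
  then obtain a c where g: "\<And>x. g x = a \<bullet> x + c" by (auto simp: affine_fun_def)
  show ?thesis
    by (rule convex_onI) (auto simp: g inner_add_right algebra_simps)
qed

lemma fractional_minimizer_unique:
  fixes f g :: "real^'m::finite \<Rightarrow> real"
  assumes "real_polynomial_function f" "convex_on UNIV f"
    and "convex_on UNIV (\<lambda>x. - g x)"
    and sign: "f v / g v \<ge> 0 \<or> affine_fun g"
    and S: "convex S" "\<And>x. x \<in> S \<Longrightarrow> g x > 0"
    and v: "is_arg_min (\<lambda>x. f x / g x) (\<lambda>x. x \<in> S) v"
    and v': "is_arg_min (\<lambda>x. f x / g x) (\<lambda>x. x \<in> S) v'"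
    and "positive_definite (hessian f v)"
  shows "v' = v"
proof (rule ccontr)
  define r d where "r = f v / g v" and "d = v' - v"
  assume "v' \<noteq> v"
  then have "d \<bullet> (hessian f v *v d) > 0"
    using assms(9) by (simp add: positive_definite_def d_def)
  moreover have "d \<bullet> (hessian f v *v d) = 0"
  proof (rule hessian_zero_along_affine_segment[OF assms(1)])
    fix s :: real assume s: "s \<in> {0..1}"
    have inS: "v \<in> S" "v' \<in> S" using v v' by (auto simp: is_arg_min_def)
    have z: "v + s *\<^sub>R d = (1 - s) *\<^sub>R v + s *\<^sub>R v'"
      by (simp add: d_def algebra_simps)
    with s inS S(1) have zS: "v + s *\<^sub>R d \<in> S"
      by (auto simp: convex_alt)
    have "f v' / g v' = r"
      using v v' inS by (auto simp: is_arg_min_linorder r_def intro: antisym)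
    then have eq: "f v = r * g v" "f v' = r * g v'"
      using S(2)[OF inS(1)] S(2)[OF inS(2)] by (auto simp: r_def nonzero_divide_eq_eq)
    \<comment> \<open>Dinkelbach's reformulation: the ratio is traded for \<open>f - r * g\<close>,
      which is convex, nonnegative on \<open>S\<close> and zero at both minimizers.\<close>
    have "convex_on UNIV (\<lambda>x. - (r * g x))"
      using assms(3) sign unfolding r_def by (rule convex_on_neg_mult)
    then have "(1 - s) * (r * g v) + s * (r * g v') \<le> r * g (v + s *\<^sub>R d)"
      using convex_onD[of UNIV "\<lambda>x. - (r * g x)" s v v'] s unfolding z by simp
    moreover have "r * g (v + s *\<^sub>R d) \<le> f (v + s *\<^sub>R d)"
      using v zS S(2)[OF zS] by (auto simp: is_arg_min_linorder r_def pos_le_divide_eq)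
    moreover have "f (v + s *\<^sub>R d) \<le> (1 - s) * f v + s * f v'"
      using convex_onD[OF assms(2), of s v v'] s unfolding z by simp
    \<comment> \<open>By \<open>eq\<close> the outer ends of the chain of inequalities coincide, so
      equality holds throughout.\<close>
    ultimately show "f (v + s *\<^sub>R d) = (1 - s) * f v + s * f (v + d)"
      by (simp add: eq d_def)
  qed
  ultimately show False by simp
qed

section \<open>Convexity of the feasible sets\<close>

lemma convex_sublevel_set:
  assumes "convex_on A f"
  shows "convex {x\<in>A. f x \<le> c}"
proof (rule convexI)
  fix x y and a b :: real
  assume xy: "x \<in> {x\<in>A. f x \<le> c}" "y \<in> {x\<in>A. f x \<le> c}" and ab: "0 \<le> a" "0 \<le> b" "a + b = 1"
  then have "f (a *\<^sub>R x + b *\<^sub>R y) \<le> a * f x + b * f y"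
    using assms by (simp add: convex_on_def)
  also have "\<dots> \<le> c"
    using xy ab by (intro convex_bound_le) auto
  finally show "a *\<^sub>R x + b *\<^sub>R y \<in> {x\<in>A. f x \<le> c}"
    using xy ab convexD[of A x y a b] assms by (auto simp: convex_on_imp_convex)
qed

lemma convex_feasible:
  assumes "A5 t f g p Y"
  shows "convex (feasible p Y)"
proof -
  have "feasible p Y = (\<Inter>y\<in>Y. {x\<in>UNIV. eval_vec2 p x y \<le> 0})"
    by (auto simp: feasible_def)
  moreover have "convex {x\<in>UNIV. eval_vec2 p x y \<le> 0}" if "y \<in> Y" for y
    using assms that by (intro convex_sublevel_set) (simp add: A5_def)
  ultimately show ?thesis by (simp only: convex_INT)
qed

lemma A6_denominator_pos:
  assumes "A6 t f g p Y" "j \<in> {1..t}" "x \<in> feasible p Y"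
  shows "eval_vec (g j) x > 0"
  using assms by (auto simp: A6_def)

lemma A6_numerator_nonneg_or_affine:
  assumes "A6 t f g p Y" "j \<in> {1..t}" "x \<in> feasible p Y"
  shows "eval_vec (f j) x \<ge> 0 \<or> affine_fun (eval_vec (g j))"
  using assms by (auto simp: A6_def)

text \<open>Feasibility of \<open>w\<close> lets \<open>A6\<close> control the coefficients
  \<open>eval_vec (g j) w\<close> and \<open>eval_vec (f j) w\<close>, which makes each added
  constraint function a sum of two convex functions.\<close>

lemma convex_scalarized_feasible:
  assumes "A5 t f g p Y" "A6 t f g p Y" "w \<in> feasible p Y"
  shows "convex (scalarized_feasible t f g p Y i w)"
proof -
  have eq: "scalarized_feasible t f g p Y i w = feasible p Y \<inter> (\<Inter>j\<in>{1..t} - {i}. {x\<in>UNIV.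
      eval_vec (g j) w * eval_vec (f j) x + - (eval_vec (f j) w * eval_vec (g j) x) \<le> 0})"
    by (auto simp: scalarized_feasible_def)
  have "convex {x\<in>UNIV.
      eval_vec (g j) w * eval_vec (f j) x + - (eval_vec (f j) w * eval_vec (g j) x) \<le> 0}"
    if j: "j \<in> {1..t} - {i}" for j
  proof (intro convex_sublevel_set convex_on_add convex_on_cmul convex_on_neg_mult)
    show "0 \<le> eval_vec (g j) w"
      using A6_denominator_pos[OF assms(2) _ assms(3)] j by (simp add: less_imp_le)
    show "0 \<le> eval_vec (f j) w \<or> affine_fun (eval_vec (g j))"
      using A6_numerator_nonneg_or_affine[OF assms(2) _ assms(3)] j by simp
  qed (use assms(1) j in \<open>auto simp: A5_def\<close>)
  with convex_feasible[OF assms(1)] show ?thesis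
    unfolding eq by (intro convex_Int convex_INT)
qed

section \<open>The scalarized problem: uniqueness and efficiency\<close>

lemma scalarized_minimizer_unique:
  assumes "A5 t f g p Y" "A6 t f g p Y" "w \<in> feasible p Y" "i \<in> {1..t}"
    and "scalarized_minimizer t f g p Y i w v" "scalarized_minimizer t f g p Y i w v'"
    and "positive_definite (hessian (eval_vec (f i)) v)"
  shows "v' = v"
proof (rule fractional_minimizer_unique)
  have min: "is_arg_min (\<lambda>x. eval_vec (f i) x / eval_vec (g i) x)
      (\<lambda>x. x \<in> scalarized_feasible t f g p Y i w) z"
    if "scalarized_minimizer t f g p Y i w z" for z
    using that unfolding scalarized_minimizer_def ratio_def[abs_def] .
  show "is_arg_min (\<lambda>x. eval_vec (f i) x / eval_vec (g i) x)
      (\<lambda>x. x \<in> scalarized_feasible t f g p Y i w) v"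
    "is_arg_min (\<lambda>x. eval_vec (f i) x / eval_vec (g i) x)
      (\<lambda>x. x \<in> scalarized_feasible t f g p Y i w) v'"
    using assms(5,6) by (auto intro: min)
  have "v \<in> feasible p Y"
    using assms(5) by (auto simp: scalarized_minimizer_def is_arg_min_def scalarized_feasible_def)
  then show "eval_vec (f i) v / eval_vec (g i) v \<ge> 0 \<or> affine_fun (eval_vec (g i))"
    using A6_numerator_nonneg_or_affine[OF assms(2,4)] A6_denominator_pos[OF assms(2,4)]
    by (meson divide_nonneg_pos)
  show "convex (scalarized_feasible t f g p Y i w)"
    by (rule convex_scalarized_feasible[OF assms(1-3)])
  show "eval_vec (g i) x > 0" if "x \<in> scalarized_feasible t f g p Y i w" for x
    using that A6_denominator_pos[OF assms(2,4)] by (simp add: scalarized_feasible_def)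
qed (use assms in \<open>auto simp: A5_def real_polynomial_function_eval_vec\<close>)

lemma unique_scalarized_minimizer_efficient:
  assumes "A6 t f g p Y" "w \<in> feasible p Y"
    and min: "scalarized_minimizer t f g p Y i w v"
    and unique: "\<And>v'. scalarized_minimizer t f g p Y i w v' \<Longrightarrow> v' = v"
    and "i \<in> {1..t}"
  shows "efficient_solution t f g p Y v"
  unfolding efficient_solution_def
proof (intro conjI ballI notI)
  show v: "v \<in> feasible p Y"
    using min by (simp add: scalarized_minimizer_def is_arg_min_def scalarized_feasible_def)
  fix x assume x: "x \<in> feasible p Y"
  assume "objective t f g x - objective t f g v \<in> uminus ` nonneg_orthant t - {0}"
  then obtain e where e: "e \<in> nonneg_orthant t" "objective t f g x - objective t f g v = - e"
    and ne: "objective t f g x - objective t f g v \<noteq> 0"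
    by blast
  have le: "ratio f g j x \<le> ratio f g j v" if "j \<in> {1..t}" for j
  proof -
    have "ratio f g j x - ratio f g j v = - e j"
      using fun_cong[OF e(2), of j] that by (simp add: objective_def)
    moreover have "0 \<le> e j"
      using e(1) that by (simp add: nonneg_orthant_def)
    ultimately show ?thesis by linarith
  qed
  \<comment> \<open>Cross-multiplying by the positive denominators: the added constraints say that
    no other ratio exceeds its value at \<open>w\<close>.\<close>
  have ratio_le_iff: "ratio f g j z \<le> ratio f g j w \<longleftrightarrow>
      eval_vec (g j) w * eval_vec (f j) z - eval_vec (f j) w * eval_vec (g j) z \<le> 0"
    if "j \<in> {1..t}" "z \<in> feasible p Y" for j z
    using A6_denominator_pos[OF assms(1) that] A6_denominator_pos[OF assms(1) that(1) assms(2)]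
    by (simp add: ratio_def pos_divide_le_eq pos_le_divide_eq mult_ac)
  \<comment> \<open>Transitivity through \<open>v\<close>: it is dominated by \<open>x\<close> and
    itself satisfies the constraints relative to \<open>w\<close>.\<close>
  have "ratio f g j x \<le> ratio f g j w" if j: "j \<in> {1..t} - {i}" for j
  proof -
    have "ratio f g j v \<le> ratio f g j w"
      using min j v
      by (subst ratio_le_iff)
        (auto simp: scalarized_minimizer_def is_arg_min_def scalarized_feasible_def)
    with le j show ?thesis by fastforce
  qed
  then have "x \<in> scalarized_feasible t f g p Y i w"
    using x by (simp add: scalarized_feasible_def ratio_le_iff)
  then have "scalarized_minimizer t f g p Y i w x"
    using min le[OF assms(5)] by (fastforce simp: scalarized_minimizer_def is_arg_min_linorder)
  then have "x = v" by (rule unique)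
  with ne show False by simp
qed

theorem proposition5p1:
  fixes t i' :: nat
    and f g :: "nat \<Rightarrow> 'm::finite rpoly"
    and p :: "('m + 'n::finite) rpoly"
    and Y :: "(real^'n) set"
    and u :: "nat \<Rightarrow> real^'m"
  assumes "A5 t f g p Y"
    and "A6 t f g p Y"
    and "i' \<in> {1..t}"
    and "u 0 \<in> feasible p Y"
    and "\<And>i. i \<in> {1..<i'} \<Longrightarrow> scalarized_minimizer t f g p Y i (u (i - 1)) (u i)"
    and "case3 t f g p Y i' (u (i' - 1)) \<or> case4 t f g p Y i' (u (i' - 1))"
  shows "(\<exists>!v. scalarized_minimizer t f g p Y i' (u (i' - 1)) v) \<and>
    (\<forall>v. scalarized_minimizer t f g p Y i' (u (i' - 1)) v \<longrightarrow> efficient_solution t f g p Y v)"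
proof -
  \<comment> \<open>The previous iterate is the initial point when \<open>i' = 1\<close>, and
    otherwise a minimizer of the preceding problem.\<close>
  have w: "u (i' - 1) \<in> feasible p Y"
  proof (cases "i' = 1")
    case True
    with assms(4) show ?thesis by simp
  next
    case False
    with assms(3) assms(5)[of "i' - 1"] show ?thesis
      by (auto simp: scalarized_minimizer_def is_arg_min_def scalarized_feasible_def)
  qed
  \<comment> \<open>Existence comes from the case hypothesis: either case supplies a minimizer with
    positive definite Hessian.\<close>
  obtain v where v: "scalarized_minimizer t f g p Y i' (u (i' - 1)) v"
    "positive_definite (hessian (eval_vec (f i')) v)"
    using assms(6) by (auto simp: case3_def case4_def)
  have unique: "v' = v" if "scalarized_minimizer t f g p Y i' (u (i' - 1)) v'" for v'
    using scalarized_minimizer_unique[OF assms(1,2) w assms(3) v(1) that v(2)] .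
  with v(1) have "efficient_solution t f g p Y v"
    using unique_scalarized_minimizer_efficient[OF assms(2) w v(1) _ assms(3)] by blast
  with v(1) unique show ?thesis by blast
qed

end
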